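(* If $G$ is an edge-regular graph with parameters $(n,k,\lambda)$, then the Gallai graph $\Gamma(G)$ and the anti-Gallai graph $\Delta(G)$ are regular graphs.
   Context: All graphs are finite and simple. An edge-regular graph with parameters $(n,k,\lambda)$ is a $k$-regular graph on $n$ vertices in which any two adjacent vertices have exactly $\lambda$ common neighbours. The Gallai graph $\Gamma(G)$ has the edges of $G$ as vertices, two being adjacent iff the corresponding edges of $G$ share a vertex but do not lie on a common triangle of $G$. The anti-Gallai graph $\Delta(G)$ has the edges of $G$ as vertices, two being adjacent iff the corresponding edges lie on a common triangle of $G$. *)

theory Defs
  imports Main
begin

record 'a sgraph =
  verts :: "'a set"
  edges :: "'a set set"

definition finite_simple_graph :: "'a sgraph \<Rightarrow> bool" where
  "finite_simple_graph G \<longleftrightarrow>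
     finite (verts G) \<and> (\<forall>e \<in> edges G. e \<subseteq> verts G \<and> card e = 2)"

definition adjacent :: "'a sgraph \<Rightarrow> 'a \<Rightarrow> 'a \<Rightarrow> bool" where
  "adjacent G u v \<longleftrightarrow> {u, v} \<in> edges G"

definition neighbours :: "'a sgraph \<Rightarrow> 'a \<Rightarrow> 'a set" where
  "neighbours G v = {u \<in> verts G. adjacent G v u}"

definition degree :: "'a sgraph \<Rightarrow> 'a \<Rightarrow> nat" where
  "degree G v = card (neighbours G v)"

definition k_regular :: "nat \<Rightarrow> 'a sgraph \<Rightarrow> bool" where
  "k_regular k G \<longleftrightarrow> finite_simple_graph G \<and> (\<forall>v \<in> verts G. degree G v = k)"

text \<open>The graph without vertices counts as regular. It occurs as the Gallai and
  anti-Gallai graph of an edgeless graph.\<close>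

definition regular :: "'a sgraph \<Rightarrow> bool" where
  "regular G \<longleftrightarrow> (\<exists>k. k_regular k G)"

definition edge_regular :: "nat \<Rightarrow> nat \<Rightarrow> nat \<Rightarrow> 'a sgraph \<Rightarrow> bool" where
  "edge_regular n k l G \<longleftrightarrow>
     k_regular k G \<and> card (verts G) = n \<and>
     (\<forall>u \<in> verts G. \<forall>v \<in> verts G. adjacent G u v \<longrightarrow>
        card (neighbours G u \<inter> neighbours G v) = l)"

text \<open>A triangle is represented by its vertex set; an edge lies on it iff it is a subset.\<close>

definition triangle :: "'a sgraph \<Rightarrow> 'a set \<Rightarrow> bool" where
  "triangle G T \<longleftrightarrow>
     T \<subseteq> verts G \<and> card T = 3 \<and> (\<forall>u \<in> T. \<forall>v \<in> T. u \<noteq> v \<longrightarrow> adjacent G u v)"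

definition on_common_triangle :: "'a sgraph \<Rightarrow> 'a set \<Rightarrow> 'a set \<Rightarrow> bool" where
  "on_common_triangle G e f \<longleftrightarrow> (\<exists>T. triangle G T \<and> e \<subseteq> T \<and> f \<subseteq> T)"

text \<open>In both constructions adjacency is between distinct edges of \<open>G\<close>, so that no loops
  arise.\<close>

definition gallai_graph :: "'a sgraph \<Rightarrow> 'a set sgraph" where
  "gallai_graph G =
     \<lparr>verts = edges G,
      edges = {{e, f} | e f. e \<in> edges G \<and> f \<in> edges G \<and> e \<noteq> f \<and>
                 e \<inter> f \<noteq> {} \<and> \<not> on_common_triangle G e f}\<rparr>"

definition anti_gallai_graph :: "'a sgraph \<Rightarrow> 'a set sgraph" where
  "anti_gallai_graph G =
     \<lparr>verts = edges G,
      edges = {{e, f} | e f. e \<in> edges G \<and> f \<in> edges G \<and> e \<noteq> f \<and>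
                 on_common_triangle G e f}\<rparr>"

end

theory Submission
  imports Defs
begin

text \<open>Fix an edge \<open>{u, v}\<close>. The other edges meeting it are the \<open>{u, w}\<close> with \<open>w\<close> in
  \<open>N(u) - {v}\<close> and the \<open>{v, w}\<close> with \<open>w\<close> in \<open>N(v) - {u}\<close>, and such an edge spans a triangle
  with \<open>{u, v}\<close> exactly when \<open>w\<close> is a common neighbour of \<open>u\<close> and \<open>v\<close>. Hence \<open>\<Delta>(G)\<close> is
  \<open>2\<lambda>\<close>-regular and \<open>\<Gamma>(G)\<close> is \<open>2(k - 1 - \<lambda>)\<close>-regular.\<close>

lemma adjacent_commute: "adjacent G u v \<longleftrightarrow> adjacent G v u"
  by (simp add: adjacent_def insert_commute)

lemma in_edges_cases:
  assumes "finite_simple_graph G" "e \<in> edges G"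
  obtains u v where "e = {u, v}" "u \<noteq> v" "u \<in> verts G" "v \<in> verts G" "adjacent G u v"
proof -
  have "card e = 2" "e \<subseteq> verts G"
    using assms by (auto simp: finite_simple_graph_def)
  then obtain u v where "e = {u, v}" "u \<noteq> v"
    by (auto simp: card_2_iff)
  with that \<open>e \<subseteq> verts G\<close> \<open>e \<in> edges G\<close> show thesis
    by (simp add: adjacent_def)
qed

lemma adjacent_in_verts:
  assumes "finite_simple_graph G" "adjacent G u v"
  shows "u \<in> verts G" "v \<in> verts G" "u \<noteq> v"
  using assms by (auto simp: finite_simple_graph_def adjacent_def)

lemma not_adjacent_self: "finite_simple_graph G \<Longrightarrow> \<not> adjacent G u u"
  using adjacent_in_verts(3)[of G u u] by auto

lemma in_neighbours_iff:
  assumes "finite_simple_graph G"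
  shows "w \<in> neighbours G u \<longleftrightarrow> adjacent G u w"
  using adjacent_in_verts(2)[OF assms, of u w] by (auto simp: neighbours_def)

lemma finite_neighbours: "finite_simple_graph G \<Longrightarrow> finite (neighbours G u)"
  by (simp add: finite_simple_graph_def neighbours_def)

lemma finite_edges: "finite_simple_graph G \<Longrightarrow> finite (edges G)"
  by (rule finite_subset[of _ "Pow (verts G)"]) (auto simp: finite_simple_graph_def)

lemma on_common_triangle_commute: "on_common_triangle G e f \<longleftrightarrow> on_common_triangle G f e"
  by (auto simp: on_common_triangle_def)

text \<open>A triangle through both edges contains the distinct vertices \<open>v\<close> and
  \<open>w\<close>, hence makes them adjacent. Conversely, the edge \<open>{v, w}\<close> closes
  \<open>{u, v, w}\<close> to a triangle.\<close>

lemma on_common_triangle_iff: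
  assumes "finite_simple_graph G" "adjacent G u v" "adjacent G u w" "w \<noteq> v"
  shows "on_common_triangle G {u, v} {u, w} \<longleftrightarrow> adjacent G v w"
proof
  assume "on_common_triangle G {u, v} {u, w}"
  with \<open>w \<noteq> v\<close> show "adjacent G v w"
    by (auto simp: on_common_triangle_def triangle_def)
next
  assume "adjacent G v w"
  with assms have "triangle G {u, v, w}"
    using adjacent_in_verts[OF assms(1)]
    by (auto simp: triangle_def adjacent_commute[of G v u] adjacent_commute[of G w u]
        adjacent_commute[of G w v] card_insert_if)
  then show "on_common_triangle G {u, v} {u, w}"
    by (auto simp: on_common_triangle_def intro!: exI[of _ "{u, v, w}"])
qed

text \<open>Two disjoint pairs have four elements and do not fit into a set of three.\<close>

lemma on_common_triangle_meet:
  assumes "finite_simple_graph G" "e \<in> edges G" "f \<in> edges G" "on_common_triangle G e f"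
  shows "e \<inter> f \<noteq> {}"
proof
  assume disj: "e \<inter> f = {}"
  obtain T where T: "card T = 3" "e \<subseteq> T" "f \<subseteq> T"
    using assms(4) by (auto simp: on_common_triangle_def triangle_def)
  have ef: "card e = 2" "card f = 2"
    using assms by (auto simp: finite_simple_graph_def)
  \<comment> \<open>An infinite set has \<open>card\<close> 0, so \<open>card T = 3\<close> forces
    finiteness.\<close>
  have "finite T"
    using T(1) card.infinite by fastforce
  then have "card (e \<union> f) \<le> card T" "finite e" "finite f"
    using T(2,3) by (simp_all add: card_mono finite_subset)
  with disj ef T(1) show False
    by (simp add: card_Un_disjoint)
qed

text \<open>Both constructions select from this set: the anti-Gallai graph keeps the edges on a
  common triangle with \<open>{u, v}\<close>, the Gallai graph the others.\<close>

lemma edges_meeting_edge: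
  assumes "finite_simple_graph G" "adjacent G u v"
  shows "{f \<in> edges G. f \<noteq> {u, v} \<and> {u, v} \<inter> f \<noteq> {}} =
    (\<lambda>w. {u, w}) ` (neighbours G u - {v}) \<union> (\<lambda>w. {v, w}) ` (neighbours G v - {u})"
    (is "?L = ?R")
proof
  show "?L \<subseteq> ?R"
  proof
    fix f assume f: "f \<in> ?L"
    then obtain x y where xy: "f = {x, y}"
      using in_edges_cases[OF assms(1)] by blast
    then obtain w where "f = {u, w} \<or> f = {v, w}"
      using f by (auto simp: insert_commute)
    with f show "f \<in> ?R"
      by (auto simp: in_neighbours_iff[OF assms(1)] adjacent_def insert_commute)
  qed
next
  show "?R \<subseteq> ?L"
    using adjacent_in_verts[OF assms]
    by (auto simp: in_neighbours_iff[OF assms(1)] adjacent_def doubleton_eq_iff)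
qed

text \<open>The only edge that the pencils at \<open>u\<close> and at \<open>v\<close> could share
  is \<open>{u, v}\<close>, which the last two hypotheses exclude.\<close>

lemma card_two_pencils:
  assumes "finite A" "finite B" "u \<noteq> v" "u \<notin> B" "v \<notin> A"
  shows "card ((\<lambda>w. {u, w}) ` A \<union> (\<lambda>w. {v, w}) ` B) = card A + card B"
proof -
  have "inj_on (\<lambda>w. {u, w}) A" "inj_on (\<lambda>w. {v, w}) B"
    by (auto simp: inj_on_def doubleton_eq_iff)
  moreover have "(\<lambda>w. {u, w}) ` A \<inter> (\<lambda>w. {v, w}) ` B = {}"
    using assms by (auto simp: doubleton_eq_iff)
  ultimately show ?thesis
    using assms by (simp add: card_Un_disjoint card_image)
qed

lemma on_common_triangle_iff_in_neighbours:
  assumes "finite_simple_graph G" "adjacent G u v" "w \<in> neighbours G u - {v}"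
  shows "on_common_triangle G {u, v} {u, w} \<longleftrightarrow> w \<in> neighbours G v"
  using assms on_common_triangle_iff[OF assms(1,2)] by (simp add: in_neighbours_iff[OF assms(1)])

lemma neighbours_anti_gallai_graph:
  assumes "finite_simple_graph G" "adjacent G u v"
  defines "C \<equiv> neighbours G u \<inter> neighbours G v"
  shows "neighbours (anti_gallai_graph G) {u, v} = (\<lambda>w. {u, w}) ` C \<union> (\<lambda>w. {v, w}) ` C"
proof -
  have e: "{u, v} \<in> edges G"
    using assms(2) by (simp add: adjacent_def)
  have tri: "on_common_triangle G {u, v} {u, w} \<longleftrightarrow> w \<in> neighbours G v"
    if "w \<in> neighbours G u - {v}" for w
    using on_common_triangle_iff_in_neighbours[OF assms(1,2) that] .
  have tri': "on_common_triangle G {u, v} {v, w} \<longleftrightarrow> w \<in> neighbours G u"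
    if "w \<in> neighbours G v - {u}" for w
    using on_common_triangle_iff_in_neighbours[OF assms(1) _ that] assms(2)
    by (simp add: adjacent_commute insert_commute)
  have "neighbours (anti_gallai_graph G) {u, v} =
      {f \<in> edges G. f \<noteq> {u, v} \<and> on_common_triangle G {u, v} f}"
    \<comment> \<open>An edge \<open>{e, f}\<close> of the new graph is an unordered pair and can
      match its defining form in either order, so the triangle relation has to be symmetric.\<close>
    using e by (auto simp: neighbours_def adjacent_def anti_gallai_graph_def
        doubleton_eq_iff[of "{u, v}"] on_common_triangle_commute)
  \<comment> \<open>Lying on a common triangle implies meeting; inserting this condition makes
    \<open>edges_meeting_edge\<close> applicable.\<close>
  also have "\<dots> = {f \<in> edges G. f \<noteq> {u, v} \<and> {u, v} \<inter> f \<noteq> {}} \<inter>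
      {f. on_common_triangle G {u, v} f}"
    using on_common_triangle_meet[OF assms(1) e] by blast
  also have "\<dots> = (\<lambda>w. {u, w}) ` C \<union> (\<lambda>w. {v, w}) ` C"
  proof -
    have "u \<notin> C" "v \<notin> C"
      by (simp_all add: C_def in_neighbours_iff[OF assms(1)] not_adjacent_self[OF assms(1)])
    then have "{w \<in> neighbours G u - {v}. w \<in> neighbours G v} = C"
      "{w \<in> neighbours G v - {u}. w \<in> neighbours G u} = C"
      by (auto simp: C_def)
    \<comment> \<open>The triangle condition moves from the edges \<open>{u, w}\<close> to their
      indices \<open>w\<close>, where \<open>tri\<close> and \<open>tri'\<close> turn it into
      membership in the other neighbourhood.\<close>
    moreover have "f ` A \<inter> Collect P = f ` {a \<in> A. P (f a)}" for f :: "'a \<Rightarrow> 'a set" and A P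
      by blast
    ultimately show ?thesis
      using tri tri' unfolding edges_meeting_edge[OF assms(1,2)]
      by (simp add: Int_Un_distrib2 cong: conj_cong)
  qed
  finally show ?thesis .
qed

text \<open>The edges on a common triangle are now removed from the two pencils. The set
  \<open>{v}\<close> is subtracted separately because \<open>v\<close> lies in
  \<open>neighbours G u\<close> but not in \<open>neighbours G v\<close>; likewise for
  \<open>u\<close>.\<close>

lemma neighbours_gallai_graph:
  assumes "finite_simple_graph G" "adjacent G u v"
  shows "neighbours (gallai_graph G) {u, v} =
    (\<lambda>w. {u, w}) ` (neighbours G u - {v} - neighbours G v) \<union>
    (\<lambda>w. {v, w}) ` (neighbours G v - {u} - neighbours G u)"
    (is "_ = ?R")
proof -
  have e: "{u, v} \<in> edges G"
    using assms(2) by (simp add: adjacent_def)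
  have tri: "on_common_triangle G {u, v} {u, w} \<longleftrightarrow> w \<in> neighbours G v"
    if "w \<in> neighbours G u - {v}" for w
    using on_common_triangle_iff_in_neighbours[OF assms(1,2) that] .
  have tri': "on_common_triangle G {u, v} {v, w} \<longleftrightarrow> w \<in> neighbours G u"
    if "w \<in> neighbours G v - {u}" for w
    using on_common_triangle_iff_in_neighbours[OF assms(1) _ that] assms(2)
    by (simp add: adjacent_commute insert_commute)
  have "neighbours (gallai_graph G) {u, v} =
      {f \<in> edges G. f \<noteq> {u, v} \<and> {u, v} \<inter> f \<noteq> {}} - {f. on_common_triangle G {u, v} f}"
    using e by (auto simp: neighbours_def adjacent_def gallai_graph_def
        doubleton_eq_iff[of "{u, v}"] on_common_triangle_commute)
  also have "\<dots> = ?R"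
  proof -
    have "(\<lambda>w. {u, w}) ` (neighbours G u - {v}) - Collect (on_common_triangle G {u, v}) =
        (\<lambda>w. {u, w}) ` (neighbours G u - {v} - neighbours G v)"
      using tri by blast
    moreover have "(\<lambda>w. {v, w}) ` (neighbours G v - {u}) - Collect (on_common_triangle G {u, v}) =
        (\<lambda>w. {v, w}) ` (neighbours G v - {u} - neighbours G u)"
      using tri' by blast
    ultimately show ?thesis
      unfolding edges_meeting_edge[OF assms] Un_Diff by (rule arg_cong2)
  qed
  finally show ?thesis .
qed

text \<open>Edges of both constructions are given as pairs of distinct vertices; this criterion
  accepts them in that form, without a cardinality computation.\<close>

lemma finite_simple_graphI:
  assumes "finite (verts G)"
    and "\<And>x. x \<in> edges G \<Longrightarrow> \<exists>u v. x = {u, v} \<and> u \<in> verts G \<and> v \<in> verts G \<and> u \<noteq> v"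
  shows "finite_simple_graph G"
  unfolding finite_simple_graph_def
proof (intro conjI ballI)
  show "finite (verts G)"
    by fact
  fix x assume "x \<in> edges G"
  then obtain u v where "x = {u, v}" "u \<in> verts G" "v \<in> verts G" "u \<noteq> v"
    using assms(2) by blast
  then show "x \<subseteq> verts G" "card x = 2"
    by simp_all
qed

lemma finite_simple_graph_anti_gallai_graph:
  assumes "finite_simple_graph G"
  shows "finite_simple_graph (anti_gallai_graph G)"
proof (rule finite_simple_graphI)
  show "finite (verts (anti_gallai_graph G))"
    using finite_edges[OF assms] by (simp add: anti_gallai_graph_def)
qed (unfold anti_gallai_graph_def sgraph.simps, blast)

lemma finite_simple_graph_gallai_graph:
  assumes "finite_simple_graph G"
  shows "finite_simple_graph (gallai_graph G)"
proof (rule finite_simple_graphI)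
  show "finite (verts (gallai_graph G))"
    using finite_edges[OF assms] by (simp add: gallai_graph_def)
qed (unfold gallai_graph_def sgraph.simps, blast)

lemma k_regular_anti_gallai_graph:
  assumes "edge_regular n k l G"
  shows "k_regular (2 * l) (anti_gallai_graph G)"
  unfolding k_regular_def
proof (intro conjI ballI)
  have G: "finite_simple_graph G"
    using assms by (simp add: edge_regular_def k_regular_def)
  then show "finite_simple_graph (anti_gallai_graph G)"
    by (rule finite_simple_graph_anti_gallai_graph)
  fix e assume "e \<in> verts (anti_gallai_graph G)"
  then have "e \<in> edges G"
    by (simp add: anti_gallai_graph_def)
  with G obtain u v where uv: "e = {u, v}" "u \<noteq> v" "u \<in> verts G" "v \<in> verts G" "adjacent G u v"
    by (rule in_edges_cases)
  \<comment> \<open>So neither end is a common neighbour, as \<open>card_two_pencils\<close>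
    requires; both pencils are indexed by the same \<open>l\<close> common neighbours.\<close>
  have "u \<notin> neighbours G u" "v \<notin> neighbours G v"
    by (simp_all add: in_neighbours_iff[OF G] not_adjacent_self[OF G])
  then show "degree (anti_gallai_graph G) e = 2 * l"
    using uv assms finite_neighbours[OF G]
    by (simp add: degree_def neighbours_anti_gallai_graph[OF G] card_two_pencils edge_regular_def)
qed

text \<open>The natural subtraction does not truncate once there is an edge: its \<open>l\<close>
  common neighbours are among the \<open>k - 1\<close> other neighbours of either end. Without edges
  the Gallai graph has no vertices and any degree will do.\<close>

lemma k_regular_gallai_graph:
  assumes "edge_regular n k l G"
  shows "k_regular (2 * (k - 1 - l)) (gallai_graph G)"
  unfolding k_regular_def
proof (intro conjI ballI)
  have G: "finite_simple_graph G"
    using assms by (simp add: edge_regular_def k_regular_def)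
  then show "finite_simple_graph (gallai_graph G)"
    by (rule finite_simple_graph_gallai_graph)
  have card_private: "card (neighbours G x - {y} - neighbours G y) = k - 1 - l"
    if "adjacent G x y" for x y
  proof -
    have xy: "x \<in> verts G" "y \<in> verts G"
      using adjacent_in_verts[OF G that] by auto
    have "y \<in> neighbours G x" "y \<notin> neighbours G y"
      using that by (simp_all add: in_neighbours_iff[OF G] not_adjacent_self[OF G])
    \<comment> \<open>Replacing \<open>neighbours G y\<close> by the common neighbours makes the
      subtracted set a subset, so the cardinalities \<open>k - 1\<close> and \<open>l\<close>
      subtract.\<close>
    moreover from this have
      "neighbours G x - {y} - neighbours G y = neighbours G x - {y} - neighbours G x \<inter> neighbours G y"
      "neighbours G x \<inter> neighbours G y \<subseteq> neighbours G x - {y}"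
      by auto
    ultimately show ?thesis
      using assms that xy finite_neighbours[OF G]
      by (simp add: card_Diff_subset edge_regular_def k_regular_def degree_def)
  qed
  fix e assume "e \<in> verts (gallai_graph G)"
  then have "e \<in> edges G"
    by (simp add: gallai_graph_def)
  with G obtain u v where uv: "e = {u, v}" "u \<noteq> v" "adjacent G u v"
    by (rule in_edges_cases)
  have "card (neighbours G u - {v} - neighbours G v) = k - 1 - l"
    "card (neighbours G v - {u} - neighbours G u) = k - 1 - l"
    using card_private uv(3) adjacent_commute[of G u v] by simp_all
  then show "degree (gallai_graph G) e = 2 * (k - 1 - l)"
    using uv finite_neighbours[OF G]
    by (simp add: degree_def neighbours_gallai_graph[OF G] card_two_pencils)
qed

theorem theorem1:
  fixes G :: "'a sgraph" and n k l :: nat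
  assumes "edge_regular n k l G"
  shows "regular (gallai_graph G) \<and> regular (anti_gallai_graph G)"
  using k_regular_gallai_graph[OF assms] k_regular_anti_gallai_graph[OF assms]
  by (auto simp: regular_def)

end
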